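(* Let $X$ be a set and let $A(x,\zeta)$ be a family of square complex matrices of fixed size, depending on a point $x\in X$ and a spectral parameter $\zeta\in\mathbb{C}$. Assume that the factorisation problems for products of these matrices that arise in the construction below are uniquely solvable (in the sense specified in the context). Let $R:X\times X\to X\times X$, $R(x,y)=(\tilde x,\tilde y)$, be the Yang-Baxter map defined by refactorisation: starting from the product $A(x,\zeta)A(y,\zeta)$, change the order of the factors to get $A(y,\zeta)A(x,\zeta)$, and refactorise it as $$A(y,\zeta)A(x,\zeta)=A(\tilde x,\zeta)A(\tilde y,\zeta)\qquad\text{for all }\zeta .$$ For $n\ge2$ let $$M(x_1,\dots,x_n;\zeta)=A(x_n,\zeta)A(x_{n-1},\zeta)\cdots A(x_1,\zeta)$$ be the monodromy matrix, and let $T_i^{(n)}:X^n\to X^n$, $i=1,\dots,n$, be the monodromy maps of $R$. Then the maps $T_i^{(n)}$, $i=1,\dots,n$, preserve the spectrum of the monodromy matrix for all $\zeta$: if $(\tilde x_1,\dots,\tilde x_n)=T_i^{(n)}(x_1,\dots,x_n)$, then $$\operatorname{Spec} M(\tilde x_1,\dots,\tilde x_n;\zeta)=\operatorname{Spec} M(x_1,\dots,x_n;\zeta)\qquad\text{for all }\zeta,$$ where $\operatorname{Spec}$ denotes the eigenvalues counted with algebraic multiplicity.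
   Context: Unique solvability is understood once the factorisation of the determinant is fixed. That is, for all $x,y\in X$ there is exactly one pair $(\tilde x,\tilde y)\in X\times X$ with $A(y,\zeta)A(x,\zeta)=A(\tilde x,\zeta)A(\tilde y,\zeta)$, $\det A(\tilde x,\zeta)=\det A(x,\zeta)$ and $\det A(\tilde y,\zeta)=\det A(y,\zeta)$ for all $\zeta$; and, likewise, a factorisation of a product of three matrices of the family into three matrices of the family, with the determinants of the successive factors prescribed, is unique. (One should think of $X$ as an algebraic variety and of $A$ as depending polynomially or rationally on $\zeta$.) Write $R(x,y)=(f(x,y),g(x,y))$. For $n\ge2$ and distinct $i,j\in\{1,\dots,n\}$, the map $R_{ij}:X^n\to X^n$ sends $(x_1,\dots,x_n)$ to the tuple whose $i$-th entry is $f(x_i,x_j)$, whose $j$-th entry is $g(x_i,x_j)$, and whose $k$-th entry is $x_k$ for $k\ne i,j$ (both for $i<j$ and for $i>j$). Products of maps denote composition, the rightmost map being applied first. A map $R$ is called a Yang-Baxter map if $R_{12}R_{13}R_{23}=R_{23}R_{13}R_{12}$ on $X^3$, and reversible if additionally $R_{21}R=\mathrm{Id}$ on $X^2$. The refactorisation map $R$ has both properties as a consequence of the uniqueness of the factorisation; they are not additional hypotheses. The monodromy maps are $T_i^{(n)}=R_{i\,i+n-1}R_{i\,i+n-2}\cdots R_{i\,i+1}$, $i=1,\dots,n$, with indices taken modulo $n$ with representatives in $\{1,\dots,n\}$; e.g. $T_1^{(n)}=R_{1n}R_{1\,n-1}\cdots R_{12}$. *)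

theory Defs
  imports
    "HOL-Library.FuncSet"
    "HOL-Computational_Algebra.Polynomial"
    "Jordan_Normal_Form.Char_Poly"
begin

(* The multiset of roots of the characteristic polynomial, each with its order as a root. *)
definition Spec :: "complex mat \<Rightarrow> complex multiset" where
  "Spec M = proots (char_poly M)"

definition is_refactorisation ::
  "'a set \<Rightarrow> ('a \<Rightarrow> complex \<Rightarrow> complex mat) \<Rightarrow> 'a \<times> 'a \<Rightarrow> 'a \<times> 'a \<Rightarrow> bool" where
  "is_refactorisation X A = (\<lambda>(x, y) (x', y').
     x' \<in> X \<and> y' \<in> X \<and>
     (\<forall>\<zeta>. A y \<zeta> * A x \<zeta> = A x' \<zeta> * A y' \<zeta> \<and>
          det (A x' \<zeta>) = det (A x \<zeta>) \<and> det (A y' \<zeta>) = det (A y \<zeta>)))"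

definition uniquely_refactorisable ::
  "'a set \<Rightarrow> ('a \<Rightarrow> complex \<Rightarrow> complex mat) \<Rightarrow> bool" where
  "uniquely_refactorisable X A \<longleftrightarrow> (\<forall>p \<in> X \<times> X. \<exists>!q. is_refactorisation X A p q)"

definition unique_triple_factorisation ::
  "'a set \<Rightarrow> ('a \<Rightarrow> complex \<Rightarrow> complex mat) \<Rightarrow> bool" where
  "unique_triple_factorisation X A \<longleftrightarrow>
     (\<forall>x\<in>X. \<forall>y\<in>X. \<forall>z\<in>X. \<forall>d1 d2 d3 :: complex \<Rightarrow> complex.
        \<exists>\<^sub>\<le>\<^sub>1 (u, v, w). u \<in> X \<and> v \<in> X \<and> w \<in> X \<and>
          (\<forall>\<zeta>. A x \<zeta> * A y \<zeta> * A z \<zeta> = A u \<zeta> * A v \<zeta> * A w \<zeta> \<and>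
               det (A u \<zeta>) = d1 \<zeta> \<and> det (A v \<zeta>) = d2 \<zeta> \<and> det (A w \<zeta>) = d3 \<zeta>))"

(* Only meaningful on X \<times> X and under uniquely_refactorisable. *)
definition refactorisation_map ::
  "'a set \<Rightarrow> ('a \<Rightarrow> complex \<Rightarrow> complex mat) \<Rightarrow> 'a \<times> 'a \<Rightarrow> 'a \<times> 'a" where
  "refactorisation_map X A p = (THE q. is_refactorisation X A p q)"

(* Points of X^n are the functions in {1..n} \<rightarrow>\<^sub>E X. *)
definition act :: "('a \<times> 'a \<Rightarrow> 'a \<times> 'a) \<Rightarrow> nat \<Rightarrow> nat \<Rightarrow> (nat \<Rightarrow> 'a) \<Rightarrow> nat \<Rightarrow> 'a" where
  "act R i j x = x(i := fst (R (x i, x j)), j := snd (R (x i, x j)))"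

definition yang_baxter_map :: "'a set \<Rightarrow> ('a \<times> 'a \<Rightarrow> 'a \<times> 'a) \<Rightarrow> bool" where
  "yang_baxter_map X R \<longleftrightarrow> R \<in> X \<times> X \<rightarrow> X \<times> X \<and>
     (\<forall>x \<in> {1..3} \<rightarrow>\<^sub>E X.
        (act R 1 2 \<circ> act R 1 3 \<circ> act R 2 3) x = (act R 2 3 \<circ> act R 1 3 \<circ> act R 1 2) x)"

definition reversible_map :: "'a set \<Rightarrow> ('a \<times> 'a \<Rightarrow> 'a \<times> 'a) \<Rightarrow> bool" where
  "reversible_map X R \<longleftrightarrow> (\<forall>x \<in> {1..2} \<rightarrow>\<^sub>E X. (act R 2 1 \<circ> act R 1 2) x = x)"

(* The representative in {1..n} of k modulo n, for k \<ge> 1. *)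
definition cyc :: "nat \<Rightarrow> nat \<Rightarrow> nat" where
  "cyc n k = (k - 1) mod n + 1"

(* R_{i,i+n-1} \<circ> ... \<circ> R_{i,i+1}: fold applies the function for the first list element first. *)
definition monodromy_map ::
  "('a \<times> 'a \<Rightarrow> 'a \<times> 'a) \<Rightarrow> nat \<Rightarrow> nat \<Rightarrow> (nat \<Rightarrow> 'a) \<Rightarrow> nat \<Rightarrow> 'a" where
  "monodromy_map R n i = fold (\<lambda>k. act R i (cyc n (i + k))) [1..<n]"

(* A(x_n) ... A(x_1) for d \<times> d matrices *)
primrec monodromy_matrix ::
  "nat \<Rightarrow> ('a \<Rightarrow> complex \<Rightarrow> complex mat) \<Rightarrow> nat \<Rightarrow> (nat \<Rightarrow> 'a) \<Rightarrow> complex \<Rightarrow> complex mat" where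
  "monodromy_matrix d A 0 x \<zeta> = 1\<^sub>m d"
| "monodromy_matrix d A (Suc n) x \<zeta> = A (x (Suc n)) \<zeta> * monodromy_matrix d A n x \<zeta>"

lemma refactorisation_map_works:
  assumes "uniquely_refactorisable X A" "p \<in> X \<times> X"
  shows "is_refactorisation X A p (refactorisation_map X A p)"
  using assms unfolding uniquely_refactorisable_def refactorisation_map_def
  by (metis theI')

lemma refactorisation_map_eqI:
  assumes "uniquely_refactorisable X A" "p \<in> X \<times> X" "is_refactorisation X A p q"
  shows "refactorisation_map X A p = q"
  using assms refactorisation_map_works[OF assms(1,2)]
  unfolding uniquely_refactorisable_def by blast

lemma act_in_PiE:
  assumes "R \<in> X \<times> X \<rightarrow> X \<times> X" "i \<in> I" "j \<in> I" "x \<in> I \<rightarrow>\<^sub>E X"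
  shows "act R i j x \<in> I \<rightarrow>\<^sub>E X"
proof -
  have "(x i, x j) \<in> X \<times> X" using assms(2-4) by auto
  then have "R (x i, x j) \<in> X \<times> X" using assms(1) by blast
  then show ?thesis using assms(2-4)
    by (auto simp: act_def PiE_iff extensional_def mem_Times_iff)
qed

lemma monodromy_map_in_PiE:
  assumes R: "R \<in> X \<times> X \<rightarrow> X \<times> X" and i: "i \<in> {1..n}" and x: "x \<in> {1..n} \<rightarrow>\<^sub>E X"
  shows "monodromy_map R n i x \<in> {1..n} \<rightarrow>\<^sub>E X"
proof -
  have c: "cyc n k \<in> {1..n}" for k using i by (auto simp: cyc_def Suc_le_eq)
  have "fold (\<lambda>k. act R i (cyc n (i + k))) ks y \<in> {1..n} \<rightarrow>\<^sub>E X"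
    if "y \<in> {1..n} \<rightarrow>\<^sub>E X" for ks y
    using that
  proof (induction ks arbitrary: y)
    case (Cons k ks)
    show ?case using Cons.IH[OF act_in_PiE[OF R i c Cons.prems]] by simp
  qed simp
  then show ?thesis using x by (simp add: monodromy_map_def)
qed

lemma refactorisation_map_reversible:
  fixes X :: "'a set"
  assumes "uniquely_refactorisable X A"
  shows "reversible_map X (refactorisation_map X A)"
  unfolding reversible_map_def
proof
  let ?R = "refactorisation_map X A"
  fix x :: "nat \<Rightarrow> 'a" assume x: "x \<in> {1..2} \<rightarrow>\<^sub>E X"
  then have X: "x 1 \<in> X" "x 2 \<in> X" by auto
  obtain u v where uv: "?R (x 1, x 2) = (u, v)" by fastforce
  have r: "is_refactorisation X A (x 1, x 2) (u, v)"
    using refactorisation_map_works[OF assms, of "(x 1, x 2)"] X uv by simp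
  then have uvX: "u \<in> X" "v \<in> X" by (auto simp: is_refactorisation_def)
  have "is_refactorisation X A (v, u) (x 2, x 1)"
    using r X by (auto simp: is_refactorisation_def)
  then have "?R (v, u) = (x 2, x 1)"
    using refactorisation_map_eqI[OF assms, of "(v, u)"] uvX by simp
  with uv show "(act ?R 2 1 \<circ> act ?R 1 2) x = x"
    by (auto simp: act_def)
qed

lemma refactorisation_map_yang_baxter:
  fixes X :: "'a set"
  assumes A: "\<And>x \<zeta>. x \<in> X \<Longrightarrow> A x \<zeta> \<in> carrier_mat d d"
    and U: "uniquely_refactorisable X A" and T: "unique_triple_factorisation X A"
  shows "yang_baxter_map X (refactorisation_map X A)"
proof -
  let ?R = "refactorisation_map X A"
  have step: "\<exists>x' y'. ?R (x, y) = (x', y') \<and> x' \<in> X \<and> y' \<in> X \<and>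
      (\<forall>\<zeta>. A y \<zeta> * A x \<zeta> = A x' \<zeta> * A y' \<zeta> \<and>
           det (A x' \<zeta>) = det (A x \<zeta>) \<and> det (A y' \<zeta>) = det (A y \<zeta>))"
    if "x \<in> X" "y \<in> X" for x y
  proof -
    obtain x' y' where e: "?R (x, y) = (x', y')" by fastforce
    have "is_refactorisation X A (x, y) (x', y')"
      using refactorisation_map_works[OF U, of "(x, y)"] that e by simp
    then show ?thesis using e unfolding is_refactorisation_def prod.case by blast
  qed
  have RX: "?R \<in> X \<times> X \<rightarrow> X \<times> X"
  proof
    fix p assume "p \<in> X \<times> X"
    then obtain x y where p: "p = (x, y)" "x \<in> X" "y \<in> X" by blast
    show "?R p \<in> X \<times> X" using step[OF p(2,3)] p(1) by (metis SigmaI)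
  qed
  have asc: "A p \<zeta> * A q \<zeta> * A r \<zeta> = A p \<zeta> * (A q \<zeta> * A r \<zeta>)"
    if "p \<in> X" "q \<in> X" "r \<in> X" for p q r \<zeta>
    using assoc_mult_mat[OF A[OF that(1)] A[OF that(2)] A[OF that(3)]] .
  have "(act ?R 1 2 \<circ> act ?R 1 3 \<circ> act ?R 2 3) x = (act ?R 2 3 \<circ> act ?R 1 3 \<circ> act ?R 1 2) x"
    if x: "x \<in> {1..3} \<rightarrow>\<^sub>E X" for x :: "nat \<Rightarrow> 'a"
  proof -
    define a b c where abc: "a = x 1" "b = x 2" "c = x 3"
    have X: "a \<in> X" "b \<in> X" "c \<in> X" using x by (auto simp: abc)
    obtain b1 c1 where 1: "?R (b, c) = (b1, c1)" "b1 \<in> X" "c1 \<in> X"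
      "\<And>\<zeta>. A c \<zeta> * A b \<zeta> = A b1 \<zeta> * A c1 \<zeta>"
      "\<And>\<zeta>. det (A b1 \<zeta>) = det (A b \<zeta>)" "\<And>\<zeta>. det (A c1 \<zeta>) = det (A c \<zeta>)"
      using step[OF X(2,3)] by blast
    obtain a1 c2 where 2: "?R (a, c1) = (a1, c2)" "a1 \<in> X" "c2 \<in> X"
      "\<And>\<zeta>. A c1 \<zeta> * A a \<zeta> = A a1 \<zeta> * A c2 \<zeta>"
      "\<And>\<zeta>. det (A a1 \<zeta>) = det (A a \<zeta>)" "\<And>\<zeta>. det (A c2 \<zeta>) = det (A c1 \<zeta>)"
      using step[OF X(1) 1(3)] by blast
    obtain a2 b2 where 3: "?R (a1, b1) = (a2, b2)" "a2 \<in> X" "b2 \<in> X"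
      "\<And>\<zeta>. A b1 \<zeta> * A a1 \<zeta> = A a2 \<zeta> * A b2 \<zeta>"
      "\<And>\<zeta>. det (A a2 \<zeta>) = det (A a1 \<zeta>)" "\<And>\<zeta>. det (A b2 \<zeta>) = det (A b1 \<zeta>)"
      using step[OF 2(2) 1(2)] by blast
    obtain a3 b3 where 4: "?R (a, b) = (a3, b3)" "a3 \<in> X" "b3 \<in> X"
      "\<And>\<zeta>. A b \<zeta> * A a \<zeta> = A a3 \<zeta> * A b3 \<zeta>"
      "\<And>\<zeta>. det (A a3 \<zeta>) = det (A a \<zeta>)" "\<And>\<zeta>. det (A b3 \<zeta>) = det (A b \<zeta>)"
      using step[OF X(1,2)] by blast
    obtain a4 c3 where 5: "?R (a3, c) = (a4, c3)" "a4 \<in> X" "c3 \<in> X"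
      "\<And>\<zeta>. A c \<zeta> * A a3 \<zeta> = A a4 \<zeta> * A c3 \<zeta>"
      "\<And>\<zeta>. det (A a4 \<zeta>) = det (A a3 \<zeta>)" "\<And>\<zeta>. det (A c3 \<zeta>) = det (A c \<zeta>)"
      using step[OF 4(2) X(3)] by blast
    obtain b4 c4 where 6: "?R (b3, c3) = (b4, c4)" "b4 \<in> X" "c4 \<in> X"
      "\<And>\<zeta>. A c3 \<zeta> * A b3 \<zeta> = A b4 \<zeta> * A c4 \<zeta>"
      "\<And>\<zeta>. det (A b4 \<zeta>) = det (A b3 \<zeta>)" "\<And>\<zeta>. det (A c4 \<zeta>) = det (A c3 \<zeta>)"
      using step[OF 4(3) 5(3)] by blast
    have L: "A c \<zeta> * A b \<zeta> * A a \<zeta> = A a2 \<zeta> * A b2 \<zeta> * A c2 \<zeta>" for \<zeta>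
      by (simp only: 1(4) asc[OF 1(2,3) X(1)] 2(4) asc[OF 1(2) 2(2,3), symmetric] 3(4))
    have R: "A c \<zeta> * A b \<zeta> * A a \<zeta> = A a4 \<zeta> * A b4 \<zeta> * A c4 \<zeta>" for \<zeta>
      by (simp only: asc[OF X(3,2,1)] 4(4) asc[OF X(3) 4(2,3), symmetric] 5(4)
          asc[OF 5(2,3) 4(3)] 6(4) asc[OF 5(2) 6(2,3)])
    let ?P = "\<lambda>(u, v, w). u \<in> X \<and> v \<in> X \<and> w \<in> X \<and>
          (\<forall>\<zeta>. A c \<zeta> * A b \<zeta> * A a \<zeta> = A u \<zeta> * A v \<zeta> * A w \<zeta> \<and>
               det (A u \<zeta>) = det (A a \<zeta>) \<and> det (A v \<zeta>) = det (A b \<zeta>) \<and>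
               det (A w \<zeta>) = det (A c \<zeta>))"
    have "Uniq ?P"
      using T[unfolded unique_triple_factorisation_def, rule_format, OF X(3,2,1),
          of "\<lambda>\<zeta>. det (A a \<zeta>)" "\<lambda>\<zeta>. det (A b \<zeta>)" "\<lambda>\<zeta>. det (A c \<zeta>)"] .
    moreover have "?P (a2, b2, c2)"
      using L 1(5,6) 2(2,3,5,6) 3(2,3,5,6) by (simp only: prod.case) simp
    moreover have "?P (a4, b4, c4)"
      using R 4(5,6) 5(2,3,5,6) 6(2,3,5,6) by (simp only: prod.case) simp
    ultimately have "(a2, b2, c2) = (a4, b4, c4)"
      by (rule Uniq_D)
    then show ?thesis
      using 1(1) 2(1) 3(1) 4(1) 5(1) 6(1) unfolding abc by (simp add: act_def fun_eq_iff)
  qed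
  with RX show ?thesis by (simp add: yang_baxter_map_def)
qed

end

(* One application of R_{ij} replaces A(x_j) A(x_i) by A(x_i') A(x_j'), where x_i', x_j' are the new
   entries. Hence T_i, whose steps i+1, ..., i+n-1 move the factor number i leftwards through all
   the others, turns the cyclically rotated monodromy matrix A(x_{i-1}) ... A(x_{i+1}) A(x_i) into
   A(x_i') A(x_{i-1}') ... A(x_{i+1}'). Both are cyclic rotations of monodromy matrices, and a cyclic
   rotation preserves the characteristic polynomial because AB and BA have the same one. *)
theory Submission
  imports Defs
begin

text \<open>The characteristic matrix inherits the block triangular shape, so its determinant splits
  along the diagonal blocks.\<close>

lemma char_poly_four_block_mat_upper_right_zero:
  fixes P :: "'a :: idom mat"
  assumes P: "P \<in> carrier_mat n n" and Q: "Q \<in> carrier_mat m n" and S: "S \<in> carrier_mat m m"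
  shows "char_poly (four_block_mat P (0\<^sub>m n m) Q S) = char_poly P * char_poly S"
proof -
  have "char_poly_matrix (four_block_mat P (0\<^sub>m n m) Q S) =
      four_block_mat (char_poly_matrix P) (0\<^sub>m n m) (map_mat (\<lambda>a. [:- a:]) Q) (char_poly_matrix S)"
    using P Q S by (intro eq_matI) (auto simp: char_poly_matrix_def)
  then show ?thesis
    unfolding char_poly_def
    using P Q S by (simp add: det_four_block_mat_upper_right_zero[of _ n _ m])
qed

(* The matrices [[AB, 0], [B, 0]] and [[0, 0], [B, BA]] are similar via [[1, A], [0, 1]]. *)
lemma char_poly_mult_commute:
  fixes A B :: "'a :: idom mat"
  assumes A: "A \<in> carrier_mat n n" and B: "B \<in> carrier_mat n n"
  shows "char_poly (A * B) = char_poly (B * A)"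
proof -
  define Z I where "Z = (0\<^sub>m n n :: 'a mat)" and "I = (1\<^sub>m n :: 'a mat)"
  have ZI: "Z \<in> carrier_mat n n" "I \<in> carrier_mat n n" by (auto simp: Z_def I_def)
  let ?M = "four_block_mat (A * B) Z B Z" and ?N = "four_block_mat Z Z B (B * A)"
  let ?P = "four_block_mat I A Z I" and ?Q = "four_block_mat I (- A) Z I"
  have neg_Z: "- (0\<^sub>m n n) = (0\<^sub>m n n :: 'a mat)" by auto
  have A_neg: "A + - A = 0\<^sub>m n n" using A by auto
  note mult = mult_four_block_mat[of _ n n _ n _ n _ _ n _ n]
  have one: "1\<^sub>m (n + n) = four_block_mat I Z Z I" by (simp add: I_def Z_def)
  have PQ: "?P * ?Q = 1\<^sub>m (n + n)"
    unfolding one using A ZI by (subst mult) (auto simp: I_def Z_def neg_Z A_neg)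
  have QP: "?Q * ?P = 1\<^sub>m (n + n)"
    unfolding one using A ZI by (subst mult) (auto simp: I_def Z_def neg_Z A_neg)
  have PN: "?P * ?N = four_block_mat (A * B) (A * (B * A)) B (B * A)"
    using A B ZI by (subst mult) (auto simp: I_def Z_def)
  \<comment> \<open>Right multiplication by \<open>?Q\<close> subtracts the first block column times
    \<open>A\<close> from the second one, which cancels \<open>A * (B * A)\<close> and
    \<open>B * A\<close>.\<close>
  have "?P * ?N * ?Q = ?M"
    unfolding PN using A B ZI
    by (subst mult) (auto simp: I_def Z_def assoc_mult_mat[of _ n n _ n _ n])
  then have "similar_mat_wit ?M ?N ?P ?Q"
    using A B ZI by (intro similar_mat_witI[OF PQ QP]) auto
  then have "char_poly ?M = char_poly ?N"
    by (intro char_poly_similar) (auto simp: similar_mat_def)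
  then have "char_poly (A * B) * char_poly Z = char_poly Z * char_poly (B * A)"
    using A B ZI by (simp add: Z_def char_poly_four_block_mat_upper_right_zero)
  \<comment> \<open>Being monic, this factor is nonzero and can be cancelled, as polynomials over an
    integral domain have no zero divisors.\<close>
  moreover have "char_poly Z \<noteq> 0"
    using degree_monic_char_poly[OF ZI(1)] by auto
  ultimately show ?thesis by simp
qed

text \<open>Keeping the list of indices apart from the matrices lets one order of factors be
  compared at different tuples, and makes cyclic rotation a swap of two concatenated lists.\<close>

definition mat_prod :: "nat \<Rightarrow> ('i \<Rightarrow> complex mat) \<Rightarrow> 'i list \<Rightarrow> complex mat" where
  "mat_prod d M js = foldr (\<lambda>j N. M j * N) js (1\<^sub>m d)"

lemma mat_prod_Nil [simp]: "mat_prod d M [] = 1\<^sub>m d"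
  and mat_prod_Cons [simp]: "mat_prod d M (j # js) = M j * mat_prod d M js"
  by (simp_all add: mat_prod_def)

lemma mat_prod_carrier:
  assumes "\<And>j. j \<in> set js \<Longrightarrow> M j \<in> carrier_mat d d"
  shows "mat_prod d M js \<in> carrier_mat d d"
  using assms by (induction js) (auto intro!: mult_carrier_mat)

lemma mat_prod_append:
  assumes "\<And>j. j \<in> set (js @ ks) \<Longrightarrow> M j \<in> carrier_mat d d"
  shows "mat_prod d M (js @ ks) = mat_prod d M js * mat_prod d M ks"
  using assms
proof (induction js)
  case Nil
  then show ?case by (simp add: left_mult_one_mat[OF mat_prod_carrier])
next
  case (Cons j js)
  then have "M j \<in> carrier_mat d d" "mat_prod d M js \<in> carrier_mat d d"
    "mat_prod d M ks \<in> carrier_mat d d"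
    by (auto intro!: mat_prod_carrier)
  with Cons show ?case by (simp add: assoc_mult_mat[of _ d d _ d _ d])
qed

lemma char_poly_mat_prod_rotate:
  assumes "\<And>j. j \<in> set (js @ ks) \<Longrightarrow> M j \<in> carrier_mat d d"
  shows "char_poly (mat_prod d M (js @ ks)) = char_poly (mat_prod d M (ks @ js))"
proof -
  have "mat_prod d M js \<in> carrier_mat d d" "mat_prod d M ks \<in> carrier_mat d d"
    using assms by (auto intro!: mat_prod_carrier)
  then show ?thesis
    using mat_prod_append[of js ks M d] mat_prod_append[of ks js M d] assms
      char_poly_mult_commute[of "mat_prod d M js" d "mat_prod d M ks"]
    by (metis Un_commute set_append)
qed

lemma monodromy_matrix_eq_mat_prod:
  "monodromy_matrix d A n x \<zeta> = mat_prod d (\<lambda>j. A (x j) \<zeta>) (rev [1..<Suc n])"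
  by (induction n) auto

text \<open>Starting after \<open>i\<close>, the indices run up to \<open>n\<close> and wrap once to
  1. The explicit list makes it visible that they are distinct and avoid \<open>i\<close>.\<close>

lemma cyc_orbit:
  assumes "i \<in> {1..n}"
  shows "map (\<lambda>k. cyc n (i + k)) [1..<n] = [Suc i..<Suc n] @ [1..<i]"
proof (rule nth_equalityI)
  fix k assume "k < length (map (\<lambda>k. cyc n (i + k)) [1..<n])"
  then have k: "Suc k < n" by simp
  show "map (\<lambda>k. cyc n (i + k)) [1..<n] ! k = ([Suc i..<Suc n] @ [1..<i]) ! k"
  \<comment> \<open>Positions count from 0 but the range starts at 1, so the entry is
    \<open>(i + k) mod n + 1\<close>. The case split is also the boundary between the two sublists,
    the first having length \<open>n - i\<close>.\<close>
  proof (cases "i + k < n")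
    case True
    then show ?thesis using assms k by (auto simp: nth_append cyc_def simp del: upt_Suc)
  next
    case False
    then have "(i + k) mod n = i + k - n"
      using assms k by (simp add: mod_if)
    then show ?thesis using assms k False
      by (auto simp: nth_append cyc_def simp del: upt_Suc)
  qed
qed (use assms in \<open>simp del: upt_Suc\<close>)

lemma fold_act_outside:
  assumes "k \<noteq> i" "k \<notin> set js"
  shows "fold (act R i) js x k = x k"
  using assms by (induction js arbitrary: x) (auto simp: act_def)

text \<open>Induction on \<open>js\<close>: the first step exchanges the two rightmost factors
  \<open>j\<close> and \<open>i\<close>, and the induction hypothesis carries factor
  \<open>i\<close> to the left through the others.\<close>

lemma mat_prod_fold_act:
  assumes A: "\<And>u. u \<in> X \<Longrightarrow> A u \<zeta> \<in> carrier_mat d d"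
    and R: "R \<in> X \<times> X \<rightarrow> X \<times> X"
    and swap: "\<And>u v. u \<in> X \<Longrightarrow> v \<in> X \<Longrightarrow>
      A v \<zeta> * A u \<zeta> = A (fst (R (u, v))) \<zeta> * A (snd (R (u, v))) \<zeta>"
    and "i \<in> I" "set js \<subseteq> I" "distinct (i # js)" "x \<in> I \<rightarrow>\<^sub>E X"
  shows "fold (act R i) js x \<in> I \<rightarrow>\<^sub>E X" (is ?closed)
    and "mat_prod d (\<lambda>j. A (fold (act R i) js x j) \<zeta>) (i # rev js) =
         mat_prod d (\<lambda>j. A (x j) \<zeta>) (rev js @ [i])" (is ?eq)
proof -
  \<comment> \<open>Both claims go through one induction, since splitting products at the final
    tuple needs its entries in \<open>X\<close>.\<close>
  have "?closed \<and> ?eq"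
    using assms(4-7)
  proof (induction js arbitrary: x)
    case Nil
    then show ?case by simp
  next
    case (Cons j js)
    define y where "y = act R i j x"
    define z where "z = fold (act R i) js y"
    define P where "P w = mat_prod d (\<lambda>k. A (w k) \<zeta>)" for w :: "nat \<Rightarrow> 'a"
    note x = Cons.prems(4)
    have y: "y \<in> I \<rightarrow>\<^sub>E X" unfolding y_def using Cons.prems by (intro act_in_PiE[OF R]) auto
    have IH: "z \<in> I \<rightarrow>\<^sub>E X" "P z (i # rev js) = P y (rev js @ [i])"
      using Cons.IH[OF Cons.prems(1) _ _ y] Cons.prems unfolding z_def P_def by auto
    have carrier: "A (w k) \<zeta> \<in> carrier_mat d d" if "w \<in> I \<rightarrow>\<^sub>E X" "k \<in> I" for w k
      using that by (intro A) auto
    have P_append: "P w (ks @ ls) = P w ks * P w ls"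
      if "w \<in> I \<rightarrow>\<^sub>E X" "set (ks @ ls) \<subseteq> I" for w ks ls
      unfolding P_def using that by (intro mat_prod_append carrier) auto
    have P_carrier: "P w ks \<in> carrier_mat d d" if "w \<in> I \<rightarrow>\<^sub>E X" "set ks \<subseteq> I" for w ks
      unfolding P_def using that by (intro mat_prod_carrier carrier) auto
    have P_single: "P w [k] = A (w k) \<zeta>" if "w \<in> I \<rightarrow>\<^sub>E X" "k \<in> I" for w k
      unfolding P_def using carrier[OF that] by simp
    have P_pair: "P x [j, i] = A (x j) \<zeta> * A (x i) \<zeta>"
      unfolding P_def using carrier[OF x, of i] Cons.prems by simp
    have ij: "i \<in> I" "j \<in> I" "i \<noteq> j" "set js \<subseteq> I" "i \<notin> set js" "j \<notin> set js"
      using Cons.prems by auto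
    \<comment> \<open>By distinctness no later step touches the entry \<open>j\<close>.\<close>
    have zj: "z j = y j" unfolding z_def using ij by (intro fold_act_outside) auto
    \<comment> \<open>The first step alters only the entries \<open>i\<close> and \<open>j\<close>,
      neither of which lies in \<open>js\<close>.\<close>
    have P_js: "P y (rev js) = P x (rev js)"
      unfolding P_def mat_prod_def using ij by (intro foldr_cong) (auto simp: y_def act_def)
    have "x i \<in> X" "x j \<in> X" using Cons.prems by auto
    then have swap_ij: "A (y i) \<zeta> * A (y j) \<zeta> = A (x j) \<zeta> * A (x i) \<zeta>"
      using swap ij(3) by (simp add: y_def act_def)
    have "P z (i # rev (j # js)) = P z ((i # rev js) @ [j])" by simp
    also have "\<dots> = P y (rev js @ [i]) * A (y j) \<zeta>"
      using ij IH P_append[of z "i # rev js" "[j]"] by (simp add: P_single zj)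
    also have "\<dots> = P y (rev js) * (A (y i) \<zeta> * A (y j) \<zeta>)"
      using ij P_append[OF y, of "rev js" "[i]"] P_carrier[OF y, of "rev js"] carrier[OF y]
      by (simp add: P_single[OF y] assoc_mult_mat[of _ d d _ d _ d])
    also have "\<dots> = P x (rev js) * (A (x j) \<zeta> * A (x i) \<zeta>)"
      by (simp only: P_js swap_ij)
    also have "\<dots> = P x (rev (j # js) @ [i])"
      using ij P_append[OF x, of "rev js" "[j, i]"] P_carrier[OF x, of "rev js"] carrier[OF x]
      by (simp add: P_pair)
    finally show ?case
      using IH(1) unfolding P_def z_def y_def by simp
  qed
  then show ?closed ?eq by auto
qed

theorem theorem2:
  fixes X :: "'a set" and A :: "'a \<Rightarrow> complex \<Rightarrow> complex mat"
    and d n i :: nat and x :: "nat \<Rightarrow> 'a" and \<zeta> :: complex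
  assumes "\<And>u z. u \<in> X \<Longrightarrow> A u z \<in> carrier_mat d d"
    and "uniquely_refactorisable X A"
    and "unique_triple_factorisation X A"
    and "n \<ge> 2" and "i \<in> {1..n}" and "x \<in> {1..n} \<rightarrow>\<^sub>E X"
  shows "Spec (monodromy_matrix d A n (monodromy_map (refactorisation_map X A) n i x) \<zeta>)
       = Spec (monodromy_matrix d A n x \<zeta>)"
proof -
  let ?R = "refactorisation_map X A"
  let ?js = "[Suc i..<Suc n] @ [1..<i]"
  define y where "y = monodromy_map ?R n i x"
  define P where "P w = mat_prod d (\<lambda>j. A (w j) \<zeta>)" for w :: "nat \<Rightarrow> 'a"
  have refac: "is_refactorisation X A (u, v) (?R (u, v))" if "u \<in> X" "v \<in> X" for u v
    using refactorisation_map_works[OF assms(2)] that by simp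
  have R: "?R \<in> X \<times> X \<rightarrow> X \<times> X"
  proof
    fix p assume "p \<in> X \<times> X"
    then have "is_refactorisation X A p (?R p)" by (rule refactorisation_map_works[OF assms(2)])
    then show "?R p \<in> X \<times> X"
      unfolding is_refactorisation_def case_prod_beta by (simp add: mem_Times_iff)
  qed
  have swap: "A v \<zeta> * A u \<zeta> = A (fst (?R (u, v))) \<zeta> * A (snd (?R (u, v))) \<zeta>"
    if "u \<in> X" "v \<in> X" for u v
    using refac[OF that] unfolding is_refactorisation_def case_prod_beta fst_conv snd_conv by blast
  have y: "y = fold (act ?R i) ?js x"
    unfolding y_def monodromy_map_def cyc_orbit[OF assms(5), symmetric] 
    by (simp only: fold_map comp_def)
  have js: "set ?js \<subseteq> {1..n}" "distinct (i # ?js)" using assms(5) by auto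
  \<comment> \<open>Here \<open>rev ?js\<close> lists i-1, ..., 1, n, ..., i+1, the cyclic
    descending order without \<open>i\<close>.\<close>
  have rotated: "P y (i # rev ?js) = P x (rev ?js @ [i])" and yX: "y \<in> {1..n} \<rightarrow>\<^sub>E X"
    using mat_prod_fold_act[of X A \<zeta> d ?R i "{1..n}" ?js x, OF assms(1) R swap assms(5) js assms(6)]
    unfolding P_def y by (simp_all only:)
  have carrier: "A (w j) \<zeta> \<in> carrier_mat d d" if "w \<in> {1..n} \<rightarrow>\<^sub>E X" "j \<in> {1..n}" for w j
    using that by (intro assms(1)) auto
  have rotate: "char_poly (P w (ks @ ls)) = char_poly (P w (ls @ ks))"
    if "w \<in> {1..n} \<rightarrow>\<^sub>E X" "set (ks @ ls) \<subseteq> {1..n}" for w ks ls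
    unfolding P_def using that by (intro char_poly_mat_prod_rotate carrier) auto
  have split: "rev [1..<Suc n] = rev [Suc i..<Suc n] @ i # rev [1..<i]"
  proof -
    have "[1..<Suc n] = [1..<i] @ [i..<Suc n]"
      using assms(5) upt_add_eq_append[of 1 i "Suc n - i"] by (simp del: upt_Suc)
    also have "[i..<Suc n] = i # [Suc i..<Suc n]"
      using assms(5) by (intro upt_conv_Cons) simp
    finally show ?thesis by simp
  qed
  \<comment> \<open>The monodromy matrix is cut just after factor \<open>i\<close>, and the block
    with indices i-1, ..., 1 is moved to the front.\<close>
  have mono: "char_poly (monodromy_matrix d A n w \<zeta>) = char_poly (P w (rev ?js @ [i]))"
    if "w \<in> {1..n} \<rightarrow>\<^sub>E X" for w
  proof -
    have "set ((rev [Suc i..<Suc n] @ [i]) @ rev [1..<i]) \<subseteq> {1..n}" using assms(5) by auto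
    from rotate[OF that this] show ?thesis
      unfolding monodromy_matrix_eq_mat_prod split P_def by (simp del: upt_Suc)
  qed
  \<comment> \<open>One further rotation brings factor \<open>i\<close> from the right end to the
    left end, the form that \<open>rotated\<close> provides for \<open>y\<close>.\<close>
  have "char_poly (monodromy_matrix d A n y \<zeta>) = char_poly (P y (i # rev ?js))"
    using mono[OF yX] rotate[OF yX, of "rev ?js" "[i]"] js(1) assms(5) by (simp del: upt_Suc)
  also have "\<dots> = char_poly (monodromy_matrix d A n x \<zeta>)"
    using mono[OF assms(6)] rotated by simp
  finally show ?thesis unfolding Spec_def y_def by simp
qed

end
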